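(* Let $\Sigma_d$ be a discrete-time system $x[k+1]=f_d(x[k],u[k])$, $y[k]=h_d(x[k],u[k])$ driven by a bounded admissible input $u$. Suppose that $\Sigma_d$ is 1) $N$-step strongly detectable, with constant $\vartheta\ge0$ and radially unbounded, positive definite function $p$; 2) IF-OFQP$(\nu,\rho,\delta)$ with $\rho>0$, $\delta\ge0$ and a storage function $V(x)$ that is continuous, positive semi-definite and radially unbounded. Let $\lambda$ be a number such that $0<\lambda<\rho$, and define $\eta_1=\frac1{4\lambda}-\nu>0$, $\eta_2=\rho-\lambda>0$. Then: i) for any $k\in\mathbb{Z}_{\ge0}$, $x[k]\in\mathcal D_1$, where $\mathcal D_1:=\{z\mid V(z)\le\xi_1\}$, $\xi_1=c_1+c_3$, $\xi_2=\max\{p(x[0]),c_2/\eta_2\}$, $c_1=\max_{z\in\mathcal C_1}V(z)$, $c_2=(N+1)[(\eta_1+\vartheta\eta_2)\|u\|^2+\delta]$, $c_3=(N+1)(\eta_1\|u\|^2+\delta)$, and $\mathcal C_1=\{z\mid p(z)\le\xi_2\}$; ii) there exists $K\in\mathbb{Z}_{\ge0}$ such that $x[k]\in\mathcal D_2$ for all $k\ge K$, where $\mathcal D_2:=\{x\mid V(x)\le\xi_3\}$, $\xi_3=c_2+c_4$, $\xi_4=(c_2+c_5)/\eta_2$, $c_2$ is as in i), $c_4=\max_{z\in\mathcal C_2}V(z)$, $c_5$ is a positive number, and $\mathcal C_2=\{z\mid p(z)\le\xi_4\}$.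
   Context: $|\cdot|$ is the Euclidean norm and $\|u\|=\sup_{k\in\mathbb{Z}_{\ge0}}|u[k]|$. The maps $f_d,h_d$ are continuous, the state is in $\mathbb{R}^n$, and input and output have the same dimension $m$. $N$-step strongly detectable ($N\in\mathbb{Z}_{\ge0}$) with $\vartheta\ge0$ and $p:\mathbb{R}^n\to\mathbb{R}_{\ge0}$: for any $k_0\in\mathbb{Z}_{\ge0}$, any initial state $x[k_0]\in\mathbb{R}^n$ and any admissible input, $\sum_{k=k_0}^{k_0+N}\vartheta|u[k]|^2+|y[k]|^2\ge p(x[k_0])$. IF-OFQP$(\nu,\rho,\delta)$ (input feedforward output feedback quasi-passive; $\nu,\rho\in\mathbb{R}$, $\delta\ge0$) with storage function $V$: for any $k_0<k_1$ in $\mathbb{Z}_{\ge0}$, any $x[k_0]$ and any admissible input, $V(x[k_1])-V(x[k_0])\le\sum_{i=k_0}^{k_1-1}\left(u[i]^\top y[i]-\nu|u[i]|^2-\rho|y[i]|^2+\delta\right)$. *)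

theory Defs
  imports "HOL-Analysis.Analysis"
begin

text \<open>
  A discrete-time system is given by its state map \<open>f\<close> and output map \<open>h\<close>. Signals are functions
  on all of \<open>nat\<close>; a solution started at time \<open>k0\<close> is only constrained from \<open>k0\<close> on.
  The class \<open>U\<close> of admissible input signals is a parameter.
\<close>

definition solution_from ::
  "(real^'n \<Rightarrow> real^'m \<Rightarrow> real^'n) \<Rightarrow> nat \<Rightarrow> (nat \<Rightarrow> real^'m) \<Rightarrow> (nat \<Rightarrow> real^'n) \<Rightarrow> bool"
  where "solution_from f k0 u x \<longleftrightarrow> (\<forall>k\<ge>k0. x (Suc k) = f (x k) (u k))"

definition sup_norm :: "(nat \<Rightarrow> 'a::real_normed_vector) \<Rightarrow> real"
  where "sup_norm u = (SUP k. norm (u k))"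

definition strongly_detectable ::
  "(nat \<Rightarrow> real^'m) set \<Rightarrow> (real^'n \<Rightarrow> real^'m \<Rightarrow> real^'n) \<Rightarrow> (real^'n \<Rightarrow> real^'m \<Rightarrow> real^'m) \<Rightarrow>
   nat \<Rightarrow> real \<Rightarrow> (real^'n \<Rightarrow> real) \<Rightarrow> bool"
  where "strongly_detectable U f h N \<theta> p \<longleftrightarrow>
    \<theta> \<ge> 0 \<and> (\<forall>z. p z \<ge> 0) \<and>
    (\<forall>k0 u x. u \<in> U \<longrightarrow> solution_from f k0 u x \<longrightarrow>
       (\<Sum>k=k0..k0+N. \<theta> * (norm (u k))\<^sup>2 + (norm (h (x k) (u k)))\<^sup>2) \<ge> p (x k0))"

definition if_ofqp ::
  "(nat \<Rightarrow> real^'m) set \<Rightarrow> (real^'n \<Rightarrow> real^'m \<Rightarrow> real^'n) \<Rightarrow> (real^'n \<Rightarrow> real^'m \<Rightarrow> real^'m) \<Rightarrow>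
   real \<Rightarrow> real \<Rightarrow> real \<Rightarrow> (real^'n \<Rightarrow> real) \<Rightarrow> bool"
  where "if_ofqp U f h \<nu> \<rho> \<delta> V \<longleftrightarrow>
    \<delta> \<ge> 0 \<and>
    (\<forall>k0 k1 u x. k0 < k1 \<longrightarrow> u \<in> U \<longrightarrow> solution_from f k0 u x \<longrightarrow>
       V (x k1) - V (x k0) \<le>
         (\<Sum>i=k0..<k1. u i \<bullet> h (x i) (u i) - \<nu> * (norm (u i))\<^sup>2
                        - \<rho> * (norm (h (x i) (u i)))\<^sup>2 + \<delta>))"

definition positive_definite :: "('a::real_normed_vector \<Rightarrow> real) \<Rightarrow> bool"
  where "positive_definite p \<longleftrightarrow> p 0 = 0 \<and> (\<forall>z. z \<noteq> 0 \<longrightarrow> p z > 0)"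

text \<open>The normalization \<open>V 0 = 0\<close>, which some authors include here, is not required.\<close>

definition positive_semidefinite :: "('a::real_normed_vector \<Rightarrow> real) \<Rightarrow> bool"
  where "positive_semidefinite V \<longleftrightarrow> (\<forall>z. V z \<ge> 0)"

definition radially_unbounded :: "('a::real_normed_vector \<Rightarrow> real) \<Rightarrow> bool"
  where "radially_unbounded V \<longleftrightarrow> filterlim V at_top at_infinity"

text \<open>
  A maximum of \<open>V\<close> over a sublevel set of \<open>p\<close> is written as a supremum. The next two lemmas justify
  this: the supremum is the maximum whenever there is one, and there is one if \<open>p\<close> is continuous.
  Without continuity of \<open>p\<close> the sublevel set need not be closed, and only the supremum is
  guaranteed to exist.
\<close>

lemma SUP_eq_maximum:
  fixes V :: "'a \<Rightarrow> real"
  assumes "z \<in> C" and "\<And>w. w \<in> C \<Longrightarrow> V w \<le> V z"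
  shows "(SUP w\<in>C. V w) = V z"
  using assms by (intro cSup_eq_maximum) auto

lemma maximum_on_sublevel:
  fixes V p :: "'a::euclidean_space \<Rightarrow> real"
  assumes "continuous_on UNIV V" and p: "continuous_on UNIV p" "radially_unbounded p"
    and ne: "p a \<le> c"
  obtains z where "p z \<le> c" "\<And>w. p w \<le> c \<Longrightarrow> V w \<le> V z" "(SUP w\<in>{w. p w \<le> c}. V w) = V z"
proof -
  have "eventually (\<lambda>w. p w > c) at_infinity"
    using p(2) unfolding radially_unbounded_def filterlim_at_top_dense by blast
  then obtain b where b: "\<And>w. b \<le> norm w \<Longrightarrow> p w > c"
    unfolding eventually_at_infinity by blast
  have "bounded {w. p w \<le> c}"
  proof (rule boundedI[where B = b])
    fix w assume "w \<in> {w. p w \<le> c}"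
    then show "norm w \<le> b"
      using b[of w] by (cases "b \<le> norm w") auto
  qed
  moreover have "closed {w. p w \<le> c}"
    by (intro closed_Collect_le p continuous_on_const)
  ultimately have "compact {w. p w \<le> c}"
    by (simp add: compact_eq_bounded_closed)
  moreover have "{w. p w \<le> c} \<noteq> {}"
    using ne by auto
  moreover have "continuous_on {w. p w \<le> c} V"
    by (rule continuous_on_subset[OF assms(1) subset_UNIV])
  ultimately obtain z where z: "z \<in> {w. p w \<le> c}" "\<forall>w\<in>{w. p w \<le> c}. V w \<le> V z"
    using continuous_attains_sup by meson
  show thesis
  proof (rule that)
    show "p z \<le> c" using z(1) by simp
    show "V w \<le> V z" if "p w \<le> c" for w using z(2) that by simp
    show "(SUP w\<in>{w. p w \<le> c}. V w) = V z"
      by (rule SUP_eq_maximum) (use z in simp_all)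
  qed
qed

end

theory Submission
  imports Defs
begin

text \<open>
  Completing the square in the supply rate, \<open>u \<bullet> y \<le> |u|\<^sup>2 / (4 lam) + lam |y|\<^sup>2\<close>, turns quasi-passivity into
  the dissipation inequality with supply \<open>\<eta>1 |u|\<^sup>2 - \<eta>2 |y|\<^sup>2 + \<delta>\<close>. This is used on windows of at most
  \<open>N + 1\<close> steps, in two ways.

  Dropping the output term shows that \<open>V\<close> grows by at most \<open>c3\<close> within a window. Over a full window,
  strong detectability bounds the output energy from below by \<open>p (x k)\<close> up to the input energy, and so
  \<open>V (x (k + N + 1)) \<le> V (x k) + c2 - \<eta>2 p (x k)\<close> (\<open>storage_full_window\<close>). Hence \<open>V\<close> cannot increase
  over a full window that starts outside a sublevel set \<open>{z. p z \<le> r}\<close> with \<open>r \<ge> c2 / \<eta>2\<close>, and it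
  decreases by at least \<open>c5\<close> if \<open>r = (c2 + c5) / \<eta>2\<close>.

  Thus a trajectory that has visited the sublevel set once can later exceed the supremum of \<open>V\<close> on it
  only by the growth \<open>c3\<close> within one window (\<open>windowed_descent_trapped\<close>). For the first claim the
  trajectory starts in the sublevel set. For the second claim it must enter the set, since \<open>V \<ge> 0\<close>
  cannot decrease by \<open>c5\<close> forever (\<open>windowed_descent_enters\<close>), and \<open>c3 \<le> c2\<close>. All suprema
  are finite because sublevel sets of a radially unbounded function are bounded.
\<close>

text \<open>
  In the application \<open>v\<close> and \<open>q\<close> are \<open>V\<close> and \<open>p\<close> along a trajectory, so \<open>q k \<le> r\<close> means that the
  sublevel set is visited at time \<open>k\<close>. Going back from time \<open>k\<close>, either the set was visited within the last \<open>M\<close> steps, so that \<open>v\<close>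
  has grown by at most \<open>c\<close> since, or \<open>v\<close> did not increase over the last \<open>M\<close> steps and induction applies.
\<close>

lemma windowed_descent_trapped:
  fixes v q :: "nat \<Rightarrow> real"
  assumes "M > 0"
    and growth: "\<And>k j. j \<le> M \<Longrightarrow> v (k + j) \<le> v k + c"
    and descent: "\<And>k. q k > r \<Longrightarrow> v (k + M) \<le> v k"
    and bound: "\<And>k. q k \<le> r \<Longrightarrow> v k \<le> b"
    and entered: "q K \<le> r"
    and "K \<le> k"
  shows "v k \<le> b + c"
  using \<open>K \<le> k\<close>
proof (induction k rule: less_induct)
  case (less k)
  have recent: "v k \<le> b + c" if "q i \<le> r" "i \<le> k" "k \<le> i + M" for i
    using growth[of "k - i" i] bound[OF that(1)] that by (simp add: le_diff_conv)
  show ?case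
  proof (cases "k \<le> K + M")
    case True
    then show ?thesis using recent entered less.prems by blast
  next
    case False
    then have k: "M \<le> k" and "k - M < k" "K \<le> k - M"
      using \<open>M > 0\<close> by auto
    show ?thesis
    proof (cases "q (k - M) \<le> r")
      case True
      then show ?thesis using recent[of "k - M"] k by simp
    next
      case False
      then have "v k \<le> v (k - M)"
        using descent[of "k - M"] k by simp
      then show ?thesis
        using less.IH[OF \<open>k - M < k\<close> \<open>K \<le> k - M\<close>] by simp
    qed
  qed
qed

lemma windowed_descent_enters:
  fixes v q :: "nat \<Rightarrow> real"
  assumes nonneg: "\<And>k. v k \<ge> 0" and "e > 0"
    and descent: "\<And>k. q k > r \<Longrightarrow> v (k + M) \<le> v k - e"
  obtains K where "q K \<le> r"
proof (rule ccontr)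
  assume "\<not> thesis"
  then have outside: "q k > r" for k
    using that[of k] by force
  have "v (j * M) \<le> v 0 - real j * e" for j
  proof (induction j)
    case (Suc j)
    then show ?case
      using descent[OF outside, of "j * M"] by (simp add: algebra_simps)
  qed simp
  moreover obtain j where "v 0 < real j * e"
    using reals_Archimedean3[OF \<open>e > 0\<close>] by blast
  ultimately show False
    using nonneg[of "j * M"] by (smt (verit))
qed

text \<open>
  The supremum is finite: radial unboundedness of \<open>p\<close> puts its sublevel set inside a ball, and \<open>V\<close> is
  bounded on that ball by compactness.
\<close>

lemma le_SUP_on_sublevel:
  fixes V p :: "'a::euclidean_space \<Rightarrow> real"
  assumes "continuous_on UNIV V" and "radially_unbounded p" and "p w \<le> c"
  shows "V w \<le> (SUP z\<in>{z. p z \<le> c}. V z)"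
proof -
  have "eventually (\<lambda>z. p z > c) at_infinity"
    using assms(2) unfolding radially_unbounded_def filterlim_at_top_dense by blast
  then obtain b where b: "\<And>z. b \<le> norm z \<Longrightarrow> p z > c"
    unfolding eventually_at_infinity by blast
  have sub: "{z. p z \<le> c} \<subseteq> cball 0 b"
  proof
    fix z assume "z \<in> {z. p z \<le> c}"
    then show "z \<in> cball 0 b"
      using b[of z] by (cases "b \<le> norm z") auto
  qed
  have "compact (V ` cball 0 b)"
    by (intro compact_continuous_image continuous_on_subset[OF assms(1)]) auto
  then have "bdd_above (V ` {z. p z \<le> c})"
    using sub by (meson bdd_above_mono bounded_imp_bdd_above compact_imp_bounded image_mono)
  then show ?thesis
    using assms(3) by (intro cSUP_upper) auto
qed

lemma norm_le_sup_norm: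
  assumes "bounded (range u)"
  shows "norm (u k) \<le> sup_norm u"
proof -
  have "bdd_above (range (\<lambda>k. norm (u k)))"
    using assms by (auto simp: bounded_iff bdd_above_def)
  then show ?thesis
    unfolding sup_norm_def by (intro cSUP_upper) auto
qed

lemma solution_from_later:
  "solution_from f k0 u x \<Longrightarrow> k0 \<le> k \<Longrightarrow> solution_from f k u x"
  by (simp add: solution_from_def)

lemma inner_le_weighted_squares:
  fixes a b :: "'a::real_inner"
  assumes "lam > 0"
  shows "a \<bullet> b \<le> (norm a)\<^sup>2 / (4 * lam) + lam * (norm b)\<^sup>2"
proof -
  have "0 \<le> (norm (a - (2 * lam) *\<^sub>R b))\<^sup>2"
    by simp
  also have "\<dots> = (norm a)\<^sup>2 - 4 * lam * (a \<bullet> b) + 4 * lam\<^sup>2 * (norm b)\<^sup>2"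
    unfolding power2_norm_eq_inner
    by (simp add: inner_diff_left inner_diff_right inner_commute power2_eq_square)
  finally show ?thesis
    using assms by (simp add: field_simps power2_eq_square)
qed

text \<open>
  The form of quasi-passivity used on every window: the cross term \<open>u \<bullet> y\<close> is absorbed by
  spending \<open>lam\<close> of the output feedback excess \<open>\<rho>\<close>, and the input is replaced by its bound \<open>B\<close>.
\<close>

lemma if_ofqp_window:
  assumes "if_ofqp U f h \<nu> \<rho> \<delta> V" and "u \<in> U" and "solution_from f k u x"
    and "lam > 0" and "1 / (4 * lam) - \<nu> \<ge> 0" and B: "\<And>i. norm (u i) \<le> B"
  shows "V (x (k + j)) \<le> V (x k) + real j * ((1 / (4 * lam) - \<nu>) * B\<^sup>2 + \<delta>)
           - (\<rho> - lam) * (\<Sum>i=k..<k+j. (norm (h (x i) (u i)))\<^sup>2)"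
proof (cases "j = 0")
  case False
  let ?y = "\<lambda>i. h (x i) (u i)"
  have "V (x (k + j)) - V (x k)
      \<le> (\<Sum>i=k..<k+j. u i \<bullet> ?y i - \<nu> * (norm (u i))\<^sup>2 - \<rho> * (norm (?y i))\<^sup>2 + \<delta>)"
    using assms(1-3) False unfolding if_ofqp_def by simp
  also have "\<dots> \<le> (\<Sum>i=k..<k+j. ((1 / (4 * lam) - \<nu>) * B\<^sup>2 + \<delta>) - (\<rho> - lam) * (norm (?y i))\<^sup>2)"
  proof (rule sum_mono)
    fix i
    have "(1 / (4 * lam) - \<nu>) * (norm (u i))\<^sup>2 \<le> (1 / (4 * lam) - \<nu>) * B\<^sup>2"
      using assms(5) B by (intro mult_left_mono power_mono) auto
    then show "u i \<bullet> ?y i - \<nu> * (norm (u i))\<^sup>2 - \<rho> * (norm (?y i))\<^sup>2 + \<delta>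
        \<le> ((1 / (4 * lam) - \<nu>) * B\<^sup>2 + \<delta>) - (\<rho> - lam) * (norm (?y i))\<^sup>2"
      using inner_le_weighted_squares[OF \<open>lam > 0\<close>, of "u i" "?y i"] by (simp add: algebra_simps)
  qed
  also have "\<dots> = real j * ((1 / (4 * lam) - \<nu>) * B\<^sup>2 + \<delta>)
      - (\<rho> - lam) * (\<Sum>i=k..<k+j. (norm (?y i))\<^sup>2)"
    by (simp add: sum_subtractf sum_distrib_left)
  finally show ?thesis by simp
qed simp

text \<open>
  Detectability bounds the output energy of a full window from below, so the state
  enters the dissipation inequality through \<open>p\<close>.
\<close>

lemma storage_full_window:
  assumes "if_ofqp U f h \<nu> \<rho> \<delta> V" and "strongly_detectable U f h N \<theta> p"
    and "u \<in> U" and "solution_from f k u x"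
    and "lam > 0" and "lam \<le> \<rho>" and "1 / (4 * lam) - \<nu> \<ge> 0" and B: "\<And>i. norm (u i) \<le> B"
  shows "V (x (k + (N + 1))) \<le> V (x k)
           + real (N + 1) * ((1 / (4 * lam) - \<nu> + \<theta> * (\<rho> - lam)) * B\<^sup>2 + \<delta>) - (\<rho> - lam) * p (x k)"
proof -
  let ?Y = "\<Sum>i=k..<k+(N+1). (norm (h (x i) (u i)))\<^sup>2"
  have "\<theta> \<ge> 0"
    using assms(2) by (simp add: strongly_detectable_def)
  have window: "{k..k+N} = {k..<k+(N+1)}"
    by auto
  have "p (x k) \<le> (\<Sum>i=k..k+N. \<theta> * (norm (u i))\<^sup>2 + (norm (h (x i) (u i)))\<^sup>2)"
    using assms(2-4) by (simp add: strongly_detectable_def)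
  also have "\<dots> \<le> (\<Sum>i=k..<k+(N+1). \<theta> * B\<^sup>2 + (norm (h (x i) (u i)))\<^sup>2)"
    unfolding window using \<open>\<theta> \<ge> 0\<close> B by (intro sum_mono add_right_mono mult_left_mono power_mono) auto
  also have "\<dots> = real (N + 1) * (\<theta> * B\<^sup>2) + ?Y"
    unfolding sum.distrib sum_constant by simp
  finally have "(\<rho> - lam) * p (x k) \<le> (\<rho> - lam) * (real (N + 1) * (\<theta> * B\<^sup>2) + ?Y)"
    using \<open>lam \<le> \<rho>\<close> by (intro mult_left_mono) auto
  moreover have "(\<rho> - lam) * (real (N + 1) * (\<theta> * B\<^sup>2) + ?Y)
      = real (N + 1) * (\<theta> * (\<rho> - lam) * B\<^sup>2) + (\<rho> - lam) * ?Y"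
    by (simp only: distrib_left mult_ac)
  moreover have "real (N + 1) * ((1 / (4 * lam) - \<nu> + \<theta> * (\<rho> - lam)) * B\<^sup>2 + \<delta>)
      = real (N + 1) * ((1 / (4 * lam) - \<nu>) * B\<^sup>2 + \<delta>) + real (N + 1) * (\<theta> * (\<rho> - lam) * B\<^sup>2)"
    by (simp only: distrib_left distrib_right add_ac)
  ultimately show ?thesis
    using if_ofqp_window[OF assms(1,3,4,5,7) B, of "N + 1"] by linarith
qed

theorem lemma4:
  fixes f :: "real^'n \<Rightarrow> real^'m \<Rightarrow> real^'n"
    and h :: "real^'n \<Rightarrow> real^'m \<Rightarrow> real^'m"
    and U :: "(nat \<Rightarrow> real^'m) set"
    and u :: "nat \<Rightarrow> real^'m"
    and x :: "nat \<Rightarrow> real^'n"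
    and p V :: "real^'n \<Rightarrow> real"
    and N :: nat
    and \<theta> \<nu> \<rho> \<delta> lam \<eta>1 \<eta>2 \<xi>1 \<xi>2 \<xi>3 \<xi>4 c1 c2 c3 c4 c5 :: real
    and C1 C2 D1 D2 :: "(real^'n) set"
  assumes "continuous_on UNIV (\<lambda>(z, v). f z v)"
    and "continuous_on UNIV (\<lambda>(z, v). h z v)"
    and "u \<in> U" and "bounded (range u)"
    and "solution_from f 0 u x"
    and "strongly_detectable U f h N \<theta> p"
    and "radially_unbounded p" and "positive_definite p"
    and "if_ofqp U f h \<nu> \<rho> \<delta> V" and "\<rho> > 0"
    and "continuous_on UNIV V" and "positive_semidefinite V" and "radially_unbounded V"
    and "0 < lam" and "lam < \<rho>"
    and "\<eta>1 = 1 / (4 * lam) - \<nu>" and "\<eta>1 > 0"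
    and "\<eta>2 = \<rho> - lam"
    and "c2 = real (N + 1) * ((\<eta>1 + \<theta> * \<eta>2) * (sup_norm u)\<^sup>2 + \<delta>)"
    and "c3 = real (N + 1) * (\<eta>1 * (sup_norm u)\<^sup>2 + \<delta>)"
    and "\<xi>2 = max (p (x 0)) (c2 / \<eta>2)"
    and "C1 = {z. p z \<le> \<xi>2}"
    and "c1 = (SUP z\<in>C1. V z)"
    and "\<xi>1 = c1 + c3"
    and "D1 = {z. V z \<le> \<xi>1}"
    and "c5 > 0"
    and "\<xi>4 = (c2 + c5) / \<eta>2"
    and "C2 = {z. p z \<le> \<xi>4}"
    and "c4 = (SUP z\<in>C2. V z)"
    and "\<xi>3 = c2 + c4"
    and "D2 = {z. V z \<le> \<xi>3}"
  shows "(\<forall>k. x k \<in> D1) \<and> (\<exists>K. \<forall>k\<ge>K. x k \<in> D2)"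
proof -
  note u = \<open>u \<in> U\<close> and sol = solution_from_later[OF \<open>solution_from f 0 u x\<close> le0]
  note ofqp = \<open>if_ofqp U f h \<nu> \<rho> \<delta> V\<close> and det = \<open>strongly_detectable U f h N \<theta> p\<close>
  note B = norm_le_sup_norm[OF \<open>bounded (range u)\<close>]
  note \<eta>1 = \<open>\<eta>1 = 1 / (4 * lam) - \<nu>\<close> and \<eta>2 = \<open>\<eta>2 = \<rho> - lam\<close>
  have \<eta>1_nonneg: "1 / (4 * lam) - \<nu> \<ge> 0" and \<eta>2_pos: "\<eta>2 > 0"
    using \<eta>1 \<eta>2 \<open>\<eta>1 > 0\<close> \<open>lam < \<rho>\<close> by auto
  have \<delta>: "\<delta> \<ge> 0" and \<theta>: "\<theta> \<ge> 0"
    using ofqp det by (auto simp: if_ofqp_def strongly_detectable_def)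
  have growth: "V (x (k + j)) \<le> V (x k) + c3" if "j \<le> N + 1" for k j
  proof -
    have "V (x (k + j)) \<le> V (x k) + real j * (\<eta>1 * (sup_norm u)\<^sup>2 + \<delta>)
        - \<eta>2 * (\<Sum>i=k..<k+j. (norm (h (x i) (u i)))\<^sup>2)"
      unfolding \<eta>1 \<eta>2 by (rule if_ofqp_window[OF ofqp u sol \<open>0 < lam\<close> \<eta>1_nonneg B])
    also have "\<dots> \<le> V (x k) + real j * (\<eta>1 * (sup_norm u)\<^sup>2 + \<delta>)"
      using \<eta>2_pos by (simp add: sum_nonneg)
    also have "\<dots> \<le> V (x k) + c3"
      unfolding \<open>c3 = _\<close> using that \<open>\<eta>1 > 0\<close> \<delta> by (intro add_left_mono mult_right_mono) auto
    finally show ?thesis .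
  qed
  have window: "V (x (k + (N + 1))) \<le> V (x k) + c2 - \<eta>2 * p (x k)" for k
    using storage_full_window[OF ofqp det u sol \<open>0 < lam\<close> less_imp_le[OF \<open>lam < \<rho>\<close>] \<eta>1_nonneg B]
    unfolding \<open>c2 = _\<close> \<eta>1 \<eta>2 .
  have trapped: "V (x k) \<le> (SUP z\<in>{z. p z \<le> r}. V z) + c3"
    if "c2 / \<eta>2 \<le> r" "p (x K) \<le> r" "K \<le> k" for r K k
  proof (rule windowed_descent_trapped[where v = "\<lambda>k. V (x k)" and q = "\<lambda>k. p (x k)" and M = "N + 1"])
    fix k assume "p (x k) > r"
    then have "c2 / \<eta>2 \<le> p (x k)"
      using that(1) by simp
    then have "c2 \<le> \<eta>2 * p (x k)"
      using \<eta>2_pos by (simp add: field_simps)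
    then show "V (x (k + (N + 1))) \<le> V (x k)"
      using window[of k] by linarith
  qed (use growth le_SUP_on_sublevel[OF \<open>continuous_on UNIV V\<close> \<open>radially_unbounded p\<close>] that in auto)
  have "x k \<in> D1" for k
  proof -
    have "V (x k) \<le> (SUP z\<in>{z. p z \<le> \<xi>2}. V z) + c3"
      by (rule trapped[where K = 0]) (auto simp: \<open>\<xi>2 = _\<close>)
    then show ?thesis
      by (simp add: \<open>D1 = _\<close> \<open>\<xi>1 = _\<close> \<open>c1 = _\<close> \<open>C1 = _\<close>)
  qed
  moreover have "\<exists>K. \<forall>k\<ge>K. x k \<in> D2"
  proof -
    obtain K where K: "p (x K) \<le> \<xi>4"
    proof (rule windowed_descent_enters[where v = "\<lambda>k. V (x k)" and q = "\<lambda>k. p (x k)"])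
      show "V (x k) \<ge> 0" for k
        using \<open>positive_semidefinite V\<close> by (simp add: positive_semidefinite_def)
      show "V (x (k + (N + 1))) \<le> V (x k) - c5" if "p (x k) > \<xi>4" for k
      proof -
        have "c2 + c5 < \<eta>2 * p (x k)"
          using that \<eta>2_pos unfolding \<open>\<xi>4 = _\<close> by (simp add: field_simps)
        then show ?thesis
          using window[of k] by linarith
      qed
    qed (use \<open>c5 > 0\<close> in auto)
    have "c3 \<le> c2"
      unfolding \<open>c3 = _\<close> \<open>c2 = _\<close> using \<theta> \<eta>2_pos
      by (intro mult_left_mono add_right_mono mult_right_mono) auto
    have "c2 / \<eta>2 \<le> \<xi>4"
      unfolding \<open>\<xi>4 = _\<close> using \<open>c5 > 0\<close> \<eta>2_pos by (intro divide_right_mono) auto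
    then have "x k \<in> D2" if "k \<ge> K" for k
      using trapped[OF _ K that] \<open>c3 \<le> c2\<close>
      by (simp add: \<open>D2 = _\<close> \<open>\<xi>3 = _\<close> \<open>c4 = _\<close> \<open>C2 = _\<close>)
    then show ?thesis by blast
  qed
  ultimately show ?thesis by blast
qed

end
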